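(* Let $n\ge 2$ and let $\Gamma$ be a finite regular cover of the rose $\mathbf{R}_n$ representing a characteristic subgroup of $\mathbf{F}_n$. Then the separability complex $\mathrm{SC}(\Gamma)$ admits an isometric action of $\mathrm{Out}(\mathbf{F}_n)$, namely the one induced by $[v]\mapsto[\phi(v)]$ on vertices (and sending an edge labeled $[\alpha]$ from $[v]$ to $[w]$ to the edge labeled $[\phi(\alpha)]$ from $[\phi(v)]$ to $[\phi(w)]$) for $\phi\in\mathrm{Aut}(\mathbf{F}_n)$. This action maps to itself the connected component of $\mathrm{SC}(\Gamma)$ containing (the conjugacy classes of) all elements of $\pi_1(\Gamma^{\mathrm{sep}})$.
   Context: $\mathbf{F}_n$ is the free group on $X_n=\{x_1,\dots,x_n\}$, and $\mathbf{R}_n$ is the rose (graph with one vertex and $n$ edges), with $\pi_1(\mathbf{R}_n)$ identified with $\mathbf{F}_n$. For a finite regular cover $\Gamma\to\mathbf{R}_n$, $\pi_1(\Gamma)$ is identified with the corresponding finite-index normal subgroup of $\mathbf{F}_n$. A proper free factor of $\mathbf{F}_n$ is a nontrivial proper subgroup $F$ such that $\mathbf{F}_n=F*G$ for some nontrivial proper subgroup $G$; $\mathcal{C}^{\mathrm{sep}}$ is the set of elements lying in some proper free factor (separable elements). $\Gamma^{\mathrm{sep}}$ is the cover of $\mathbf{R}_n$ representing the subgroup $\pi_1(\Gamma^{\mathrm{sep}})$ of $\pi_1(\Gamma)$ generated by $\mathcal{C}^{\mathrm{sep}}\cap\pi_1(\Gamma)$. The separability complex $\mathrm{SC}(\Gamma)$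 is the directed graph defined as follows. Its vertices are the $\mathbf{F}_n$-conjugacy classes $[v]$ of elements $v\in\pi_1(\Gamma)$. Each edge is labeled by the $\mathbf{F}_n$-conjugacy class $[\alpha]$ of a nontrivial element of $\mathcal{C}^{\mathrm{sep}}\cap\pi_1(\Gamma)$; there is an edge labeled $[\alpha]$ from $[v]$ to $[w]$ whenever there are $\hat\alpha\in[\alpha]$, $\hat v\in[v]$, $\hat w\in[w]$ with $\hat w=\hat v\hat\alpha$ in $\mathbf{F}_n$. It carries the path metric in which every edge has length one (with infinite distance between distinct components). *)

theory Defs
  imports
    "HOL-Algebra.Group_Action"
    "HOL-Algebra.Generated_Groups"
    "Graph_Theory.Bidirected_Digraph"
    "Graph_Theory.Digraph_Component"
    "Graph_Theory.Shortest_Path"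
begin

section \<open>Free groups\<close>

text \<open>The letter \<open>(True, x)\<close> is the generator \<open>x\<close>, the letter \<open>(False, x)\<close> its inverse.\<close>

type_synonym 'x letter = "bool \<times> 'x"

definition inv_letter :: "'x letter \<Rightarrow> 'x letter" where
  "inv_letter l = (\<not> fst l, snd l)"

definition reduced :: "'x letter list \<Rightarrow> bool" where
  "reduced w \<longleftrightarrow> successively (\<lambda>l m. m \<noteq> inv_letter l) w"

fun cancel_cons :: "'x letter \<Rightarrow> 'x letter list \<Rightarrow> 'x letter list" where
  "cancel_cons l [] = [l]"
| "cancel_cons l (m # w) = (if m = inv_letter l then w else l # m # w)"

definition reduce :: "'x letter list \<Rightarrow> 'x letter list" where
  "reduce w = foldr cancel_cons w []"

definition free_group :: "'x set \<Rightarrow> 'x letter list monoid" where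
  "free_group X = \<lparr>carrier = {w. reduced w \<and> snd ` set w \<subseteq> X},
                   monoid.mult = (\<lambda>u v. reduce (u @ v)), one = []\<rparr>"


section \<open>Group-theoretic notions\<close>

definition conj_class :: "('a, 'b) monoid_scheme \<Rightarrow> 'a \<Rightarrow> 'a set" where
  "conj_class G v = {g \<otimes>\<^bsub>G\<^esub> v \<otimes>\<^bsub>G\<^esub> inv\<^bsub>G\<^esub> g | g. g \<in> carrier G}"

definition Inn :: "('a, 'b) monoid_scheme \<Rightarrow> ('a \<Rightarrow> 'a) set" where
  "Inn G = (\<lambda>g. \<lambda>x\<in>carrier G. g \<otimes>\<^bsub>G\<^esub> x \<otimes>\<^bsub>G\<^esub> inv\<^bsub>G\<^esub> g) ` carrier G"

definition Out :: "('a, 'b) monoid_scheme \<Rightarrow> ('a \<Rightarrow> 'a) set monoid" where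
  "Out G = AutoGroup G Mod Inn G"

definition outer_class :: "('a, 'b) monoid_scheme \<Rightarrow> ('a \<Rightarrow> 'a) \<Rightarrow> ('a \<Rightarrow> 'a) set" where
  "outer_class G \<phi> = Inn G #>\<^bsub>AutoGroup G\<^esub> \<phi>"

definition characteristic_subgroup :: "'a set \<Rightarrow> ('a, 'b) monoid_scheme \<Rightarrow> bool" where
  "characteristic_subgroup H G \<longleftrightarrow> subgroup H G \<and> (\<forall>\<phi>\<in>carrier (AutoGroup G). \<phi> ` H = H)"

text \<open>The elements of the free product \<open>A * B\<close> are the alternating words in nontrivial elements
  of \<open>A\<close> (tagged \<open>True\<close>) and of \<open>B\<close> (tagged \<open>False\<close>); \<open>G\<close> is the (internal) free product of its
  subgroups \<open>A\<close> and \<open>B\<close> if the canonical map from these words to \<open>G\<close> is bijective.\<close>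

definition alternating_words ::
    "('a, 'b) monoid_scheme \<Rightarrow> 'a set \<Rightarrow> 'a set \<Rightarrow> (bool \<times> 'a) list set" where
  "alternating_words G A B =
     {ws. successively (\<lambda>s t. fst s \<noteq> fst t) ws \<and>
          (\<forall>(b, x)\<in>set ws. x \<in> (if b then A else B) - {\<one>\<^bsub>G\<^esub>})}"

definition word_value :: "('a, 'b) monoid_scheme \<Rightarrow> (bool \<times> 'a) list \<Rightarrow> 'a" where
  "word_value G ws = foldr (\<lambda>s y. snd s \<otimes>\<^bsub>G\<^esub> y) ws \<one>\<^bsub>G\<^esub>"

definition is_free_product :: "('a, 'b) monoid_scheme \<Rightarrow> 'a set \<Rightarrow> 'a set \<Rightarrow> bool" where
  "is_free_product G A B \<longleftrightarrow> subgroup A G \<and> subgroup B G \<and>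
     bij_betw (word_value G) (alternating_words G A B) (carrier G)"

definition proper_free_factor :: "('a, 'b) monoid_scheme \<Rightarrow> 'a set \<Rightarrow> bool" where
  "proper_free_factor G A \<longleftrightarrow>
     subgroup A G \<and> A \<noteq> {\<one>\<^bsub>G\<^esub>} \<and> A \<noteq> carrier G \<and>
     (\<exists>B. subgroup B G \<and> B \<noteq> {\<one>\<^bsub>G\<^esub>} \<and> B \<noteq> carrier G \<and> is_free_product G A B)"

definition separable :: "('a, 'b) monoid_scheme \<Rightarrow> 'a set" where
  "separable G = {x. \<exists>A. proper_free_factor G A \<and> x \<in> A}"


section \<open>Covers of the rose\<close>

text \<open>Graphs are graphs in the sense of Serre: every geometric edge is a pair of opposite arcs,
  exchanged by a fixed-point free involution of the arcs.\<close>

definition rose :: "nat \<Rightarrow> (unit, nat letter) pre_digraph" where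
  "rose n = \<lparr>verts = {()}, arcs = {l. snd l \<in> {1..n}}, tail = (\<lambda>_. ()), head = (\<lambda>_. ())\<rparr>"

definition rose_rev :: "nat \<Rightarrow> nat letter \<Rightarrow> nat letter" where
  "rose_rev n l = (if l \<in> arcs (rose n) then inv_letter l else l)"

locale graph_covering =
  E: bidirected_digraph E revE + B: bidirected_digraph B revB
  for E :: "('v, 'e) pre_digraph" and revE :: "'e \<Rightarrow> 'e"
    and B :: "('w, 'f) pre_digraph" and revB :: "'f \<Rightarrow> 'f" +
  fixes pv :: "'v \<Rightarrow> 'w" and pe :: "'e \<Rightarrow> 'f"
  assumes pv_onto: "pv ` verts E = verts B"
    and pe_arcs: "e \<in> arcs E \<Longrightarrow> pe e \<in> arcs B"
    and pe_tail: "e \<in> arcs E \<Longrightarrow> tail B (pe e) = pv (tail E e)"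
    and pe_head: "e \<in> arcs E \<Longrightarrow> head B (pe e) = pv (head E e)"
    and pe_rev: "e \<in> arcs E \<Longrightarrow> pe (revE e) = revB (pe e)"
    and local_bij: "v \<in> verts E \<Longrightarrow> bij_betw pe (out_arcs E v) (out_arcs B (pv v))"
begin

definition deck_transformation :: "('v \<Rightarrow> 'v) \<Rightarrow> ('e \<Rightarrow> 'e) \<Rightarrow> bool" where
  "deck_transformation s t \<longleftrightarrow>
     bij_betw s (verts E) (verts E) \<and> bij_betw t (arcs E) (arcs E) \<and>
     (\<forall>v\<in>verts E. pv (s v) = pv v) \<and>
     (\<forall>e\<in>arcs E. tail E (t e) = s (tail E e) \<and> head E (t e) = s (head E e) \<and>
                 t (revE e) = revE (t e) \<and> pe (t e) = pe e)"

end

locale finite_regular_covering = graph_covering E revE B revB pv pe + fin_digraph E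
  for E :: "('v, 'e) pre_digraph" and revE B revB pv pe +
  assumes connected: "Digraph_Component.connected E"
    and regular: "\<lbrakk>u \<in> verts E; v \<in> verts E; pv u = pv v\<rbrakk> \<Longrightarrow> \<exists>s t. deck_transformation s t \<and> s u = v"

text \<open>The subgroup of \<open>free_group {1..n}\<close> (the fundamental group of the rose) that is the image of
  the fundamental group of the cover based at \<open>v\<close>: a closed walk is mapped to the word spelled
  by its arcs, and homotopy of walks in the rose is free reduction of words.\<close>

definition pi1 :: "('v, 'e) pre_digraph \<Rightarrow> ('e \<Rightarrow> nat letter) \<Rightarrow> 'v \<Rightarrow> nat letter list set" where
  "pi1 E pe v = {reduce (map pe \<gamma>) | \<gamma>. pre_digraph.awalk E v \<gamma> v}"


section \<open>The separability complex\<close>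

text \<open>In the following, \<open>G\<close> is the ambient free group and \<open>H\<close> its subgroup represented by the
  cover.\<close>

definition pi1_sep :: "('a, 'b) monoid_scheme \<Rightarrow> 'a set \<Rightarrow> 'a set" where
  "pi1_sep G H = generate G (separable G \<inter> H)"

text \<open>An edge is the triple of its origin, its label and its terminus.\<close>

definition separability_complex ::
    "('a, 'b) monoid_scheme \<Rightarrow> 'a set \<Rightarrow> ('a set, 'a set \<times> 'a set \<times> 'a set) pre_digraph" where
  "separability_complex G H =
     \<lparr>verts = conj_class G ` H,
      arcs = {(V, A, W). V \<in> conj_class G ` H \<and> W \<in> conj_class G ` H \<and>
                A \<in> conj_class G ` (separable G \<inter> H - {\<one>\<^bsub>G\<^esub>}) \<and>
                (\<exists>v\<in>V. \<exists>a\<in>A. \<exists>w\<in>W. w = v \<otimes>\<^bsub>G\<^esub> a)},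
      tail = (\<lambda>(V, A, W). V), head = (\<lambda>(V, A, W). W)\<rparr>"

text \<open>Unit edge lengths; edges may be traversed in both directions, and the distance of vertices
  in different components is \<open>\<infinity>\<close> (the infimum of the empty set).\<close>

definition path_dist :: "('a, 'b) pre_digraph \<Rightarrow> 'a \<Rightarrow> 'a \<Rightarrow> ereal" where
  "path_dist D u v = wf_digraph.\<mu> (with_proj (mk_symmetric D)) (\<lambda>_. 1) u v"

definition connected_component :: "('a, 'b) pre_digraph \<Rightarrow> ('a, 'b) pre_digraph \<Rightarrow> bool" where
  "connected_component D C \<longleftrightarrow> pre_digraph.max_subgraph D Digraph_Component.connected C"

end

theory Submission
  imports Defs
begin

text \<open>Automorphisms permute the proper free factors, hence preserve separability, and they preserve a
  characteristic subgroup; so they act on the complex by taking images of conjugacy classes. Inner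
  automorphisms fix every conjugacy class, so the action descends to the outer automorphism group.
  It is isometric because it carries walks to walks and is invertible. It fixes the vertex
  \<open>[1]\<close>, hence preserves the component of \<open>[1]\<close>; multiplying by the separable generators one at
  a time joins \<open>[1]\<close> to the class of every element of the subgroup they generate.\<close>

section \<open>Free groups\<close>

lemma inv_letter_inv_letter [simp]: "inv_letter (inv_letter l) = l"
  by (simp add: inv_letter_def)

lemma reduced_Nil [simp]: "reduced []"
  by (simp add: reduced_def)

lemma reduced_cancel_cons: "reduced w \<Longrightarrow> reduced (cancel_cons l w)"
  by (cases w) (auto simp: reduced_def successively_Cons)

text \<open>If \<open>w\<close> does not start with \<open>l\<close>, then
  \<open>inv_letter l\<close> is prepended and \<open>l\<close> deletes it. If it does, that
  \<open>l\<close> is deleted, and reducedness of \<open>w\<close> ensures that the letter then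
  exposed is not \<open>inv_letter l\<close>, so the \<open>l\<close> is put back.\<close>

lemma cancel_cons_inv_letter:
  "reduced w \<Longrightarrow> cancel_cons l (cancel_cons (inv_letter l) w) = w"
  by (cases w; cases "tl w") (auto simp: reduced_def)

lemma reduced_foldr_cancel_cons: "reduced w \<Longrightarrow> reduced (foldr cancel_cons u w)"
  by (induction u) (auto simp: reduced_cancel_cons)

lemma reduced_reduce: "reduced (reduce w)"
  by (simp add: reduce_def reduced_foldr_cancel_cons)

lemma set_cancel_cons: "set (cancel_cons l w) \<subseteq> insert l (set w)"
  by (cases w) auto

lemma set_reduce: "set (reduce w) \<subseteq> set w"
  unfolding reduce_def by (induction w) (use set_cancel_cons in \<open>fastforce+\<close>)

lemma reduce_reduced: "reduced w \<Longrightarrow> reduce w = w"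
proof (induction w)
  case (Cons l w)
  then have "reduce w = w" by (auto simp: reduced_def successively_Cons)
  with Cons.prems show ?case
    by (cases w) (auto simp: reduce_def reduced_def)
qed (simp add: reduce_def)

text \<open>Read \<open>foldr cancel_cons u\<close> as the action of \<open>u\<close> on reduced
  words. Only the case where \<open>l\<close> deletes the first letter of \<open>u\<close> matters:
  there \<open>l\<close> and that letter, its inverse, act one after the other as the
  identity.\<close>

lemma foldr_cancel_cons_cancel_cons:
  "reduced w \<Longrightarrow>
    foldr cancel_cons (cancel_cons l u) w = cancel_cons l (foldr cancel_cons u w)"
  by (cases u) (auto simp: cancel_cons_inv_letter reduced_foldr_cancel_cons)

text \<open>Free reduction does not change the action of words on reduced words; associativity of the
  multiplication reduces to this.\<close>

lemma foldr_cancel_cons_reduce: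
  "reduced w \<Longrightarrow> foldr cancel_cons (reduce u) w = foldr cancel_cons u w"
  by (induction u) (auto simp: reduce_def foldr_cancel_cons_cancel_cons)

lemma reduce_append_right: "reduce (u @ reduce v) = reduce (u @ v)"
  using reduce_reduced[OF reduced_reduce, of v] by (simp add: reduce_def)

lemma reduce_append_left: "reduce (reduce u @ v) = reduce (u @ v)"
proof -
  have "foldr cancel_cons (reduce u) (reduce v) = foldr cancel_cons u (reduce v)"
    by (simp add: foldr_cancel_cons_reduce reduced_reduce)
  then show ?thesis by (simp add: reduce_def)
qed

text \<open>The first letter of \<open>u\<close> acts last, and the reversal makes its inverse act
  first, so the letters are undone one by one from the outside.\<close>

lemma foldr_cancel_cons_inverse:
  "reduced w \<Longrightarrow> foldr cancel_cons (rev (map inv_letter u)) (foldr cancel_cons u w) = w"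
proof (induction u)
  case (Cons l u)
  then show ?case
    using cancel_cons_inv_letter[OF reduced_foldr_cancel_cons[OF Cons.prems], of "inv_letter l" u]
    by simp
qed simp

lemma reduce_inverse_append: "reduce (rev (map inv_letter u) @ u) = []"
  using foldr_cancel_cons_inverse[of "[]" u] by (simp add: reduce_def)

lemma group_free_group: "group (free_group X)"
proof (rule groupI)
  fix x y assume "x \<in> carrier (free_group X)" "y \<in> carrier (free_group X)"
  then have "snd ` set (x @ y) \<subseteq> X" by (simp add: free_group_def image_Un)
  then have "snd ` set (reduce (x @ y)) \<subseteq> X"
    using image_mono[OF set_reduce] by (rule order_trans[rotated])
  then show "x \<otimes>\<^bsub>free_group X\<^esub> y \<in> carrier (free_group X)"
    by (simp add: free_group_def reduced_reduce)
next
  fix x assume x: "x \<in> carrier (free_group X)"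
  \<comment> \<open>Applying \<open>reduce\<close> to the formal inverse gives membership in the
    carrier without an argument that this word is already reduced.\<close>
  let ?y = "reduce (rev (map inv_letter x))"
  have "snd ` set (rev (map inv_letter x)) \<subseteq> X"
    using x by (auto simp: free_group_def inv_letter_def)
  then have "snd ` set ?y \<subseteq> X"
    using image_mono[OF set_reduce] by (rule order_trans[rotated])
  then have "?y \<in> carrier (free_group X)"
    by (simp add: free_group_def reduced_reduce)
  moreover have "?y \<otimes>\<^bsub>free_group X\<^esub> x = \<one>\<^bsub>free_group X\<^esub>"
    by (simp add: free_group_def reduce_append_left reduce_inverse_append)
  ultimately show "\<exists>y\<in>carrier (free_group X). y \<otimes>\<^bsub>free_group X\<^esub> x = \<one>\<^bsub>free_group X\<^esub>"
    by blast
qed (auto simp: free_group_def reduce_append_left reduce_append_right reduce_reduced)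


section \<open>Automorphisms and outer automorphisms\<close>

lemma carrier_AutoGroup [simp]: "carrier (AutoGroup G) = auto G"
  by (simp add: AutoGroup_def)

lemma mult_AutoGroup:
  "\<phi> \<in> auto G \<Longrightarrow> \<psi> \<in> auto G \<Longrightarrow> \<phi> \<otimes>\<^bsub>AutoGroup G\<^esub> \<psi> = compose (carrier G) \<phi> \<psi>"
  by (simp add: AutoGroup_def BijGroup_def auto_def)

lemma auto_bij: "\<phi> \<in> auto G \<Longrightarrow> bij_betw \<phi> (carrier G) (carrier G)"
  by (simp add: auto_def Bij_def)

lemma auto_closed: "\<phi> \<in> auto G \<Longrightarrow> x \<in> carrier G \<Longrightarrow> \<phi> x \<in> carrier G"
  by (auto simp: auto_def hom_def)

lemma auto_mult:
  "\<phi> \<in> auto G \<Longrightarrow> x \<in> carrier G \<Longrightarrow> y \<in> carrier G \<Longrightarrow> \<phi> (x \<otimes>\<^bsub>G\<^esub> y) = \<phi> x \<otimes>\<^bsub>G\<^esub> \<phi> y"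
  by (simp add: auto_def hom_def)

text \<open>Bijectivity comes from the two laws: \<open>f (inv k)\<close> inverts
  \<open>f k\<close>. The maps are restricted because the elements of \<open>BijGroup E\<close> are
  extensional functions.\<close>

lemma group_actionI:
  assumes "group K"
    and closed: "\<And>k x. k \<in> carrier K \<Longrightarrow> x \<in> E \<Longrightarrow> f k x \<in> E"
    and one: "\<And>x. x \<in> E \<Longrightarrow> f \<one>\<^bsub>K\<^esub> x = x"
    and mult: "\<And>k l x. k \<in> carrier K \<Longrightarrow> l \<in> carrier K \<Longrightarrow> x \<in> E \<Longrightarrow>
                 f (k \<otimes>\<^bsub>K\<^esub> l) x = f k (f l x)"
  shows "group_action K E (\<lambda>k. restrict (f k) E)"
proof -
  interpret group K by fact
  have Bij: "restrict (f k) E \<in> Bij E" if "k \<in> carrier K" for k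
  proof -
    have "f (inv\<^bsub>K\<^esub> k) (f k x) = x" "f k (f (inv\<^bsub>K\<^esub> k) x) = x" if "x \<in> E" for x
      using that \<open>k \<in> carrier K\<close> one mult[of "inv\<^bsub>K\<^esub> k" k x] mult[of k "inv\<^bsub>K\<^esub> k" x] by simp_all
    then have "bij_betw (restrict (f k) E) E E"
      by (intro bij_betw_byWitness[where f' = "f (inv\<^bsub>K\<^esub> k)"])
        (use closed \<open>k \<in> carrier K\<close> in auto)
    then show ?thesis by (simp add: Bij_def)
  qed
  have "restrict (f (k \<otimes>\<^bsub>K\<^esub> l)) E = compose E (restrict (f k) E) (restrict (f l) E)"
    if "k \<in> carrier K" "l \<in> carrier K" for k l
    using that by (auto simp: compose_def fun_eq_iff mult closed)
  then have "(\<lambda>k. restrict (f k) E) \<in> hom K (BijGroup E)"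
    by (simp add: hom_def BijGroup_def Bij)
  then show ?thesis
    unfolding group_action_def
    by (intro group_hom.intro group_hom_axioms.intro is_group group_BijGroup)
qed

context group
begin

text \<open>Together with \<open>m_assoc\<close>, which brackets to the right, these rules let the
  simplifier cancel inside longer products.\<close>

lemma inv_mult_cancel_left:
  assumes "g \<in> carrier G" "x \<in> carrier G"
  shows "inv g \<otimes> (g \<otimes> x) = x" "g \<otimes> (inv g \<otimes> x) = x"
  using assms by (simp_all add: m_assoc[symmetric])

lemma auto_group_hom: "\<phi> \<in> auto G \<Longrightarrow> group_hom G G \<phi>"
  by (intro group_hom.intro group_hom_axioms.intro) (auto simp: auto_def)

lemma auto_one: "\<phi> \<in> auto G \<Longrightarrow> \<phi> \<one> = \<one>"
  using group_hom.hom_one[OF auto_group_hom] .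

lemma auto_inv: "\<phi> \<in> auto G \<Longrightarrow> x \<in> carrier G \<Longrightarrow> \<phi> (inv x) = inv (\<phi> x)"
  using group_hom.hom_inv[OF auto_group_hom] .

lemma restrict_conj_in_auto:
  assumes g: "g \<in> carrier G"
  shows "(\<lambda>x\<in>carrier G. g \<otimes> x \<otimes> inv g) \<in> auto G"
proof -
  have "bij_betw (\<lambda>x\<in>carrier G. g \<otimes> x \<otimes> inv g) (carrier G) (carrier G)"
    by (rule bij_betw_byWitness[where f' = "\<lambda>x. inv g \<otimes> x \<otimes> g"])
      (use g in \<open>auto simp: m_assoc inv_mult_cancel_left\<close>)
  moreover have "(\<lambda>x\<in>carrier G. g \<otimes> x \<otimes> inv g) \<in> hom G G"
    by (rule homI) (use g in \<open>auto simp: m_assoc inv_mult_cancel_left\<close>)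
  ultimately show ?thesis by (simp add: auto_def Bij_def)
qed

section \<open>Inner automorphisms and the quotient by them\<close>

lemma Inn_subset_auto: "Inn G \<subseteq> auto G"
  by (auto simp: Inn_def restrict_conj_in_auto)

text \<open>Exhibits \<open>Inn G\<close> as the image of a homomorphism, hence as a subgroup of the
  automorphism group.\<close>

lemma Inn_hom: "(\<lambda>g. \<lambda>x\<in>carrier G. g \<otimes> x \<otimes> inv g) \<in> hom G (AutoGroup G)"
proof (rule homI)
  fix g h assume gh: "g \<in> carrier G" "h \<in> carrier G"
  show "(\<lambda>x\<in>carrier G. (g \<otimes> h) \<otimes> x \<otimes> inv (g \<otimes> h)) =
      (\<lambda>x\<in>carrier G. g \<otimes> x \<otimes> inv g) \<otimes>\<^bsub>AutoGroup G\<^esub> (\<lambda>x\<in>carrier G. h \<otimes> x \<otimes> inv h)"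
    unfolding mult_AutoGroup[OF gh[THEN restrict_conj_in_auto]]
    using gh by (auto simp: compose_def fun_eq_iff m_assoc inv_mult_group)
qed (use restrict_conj_in_auto in simp)

lemma normal_Inn: "Inn G \<lhd> AutoGroup G"
proof -
  interpret A: group "AutoGroup G" by (rule AutoGroup)
  interpret h: group_hom G "AutoGroup G" "\<lambda>g. \<lambda>x\<in>carrier G. g \<otimes> x \<otimes> inv g"
    by unfold_locales (rule Inn_hom)
  have "\<phi> \<otimes>\<^bsub>AutoGroup G\<^esub> \<iota> \<otimes>\<^bsub>AutoGroup G\<^esub> inv\<^bsub>AutoGroup G\<^esub> \<phi> \<in> Inn G"
    if \<phi>: "\<phi> \<in> auto G" and "\<iota> \<in> Inn G" for \<phi> \<iota>
  proof -
    obtain g where g: "g \<in> carrier G" and \<iota>: "\<iota> = (\<lambda>x\<in>carrier G. g \<otimes> x \<otimes> inv g)"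
      using \<open>\<iota> \<in> Inn G\<close> by (auto simp: Inn_def)
    \<comment> \<open>Conjugating conjugation by \<open>g\<close> with \<open>\<phi>\<close> yields
      conjugation by \<open>\<phi> g\<close>. This is checked below in the form
      \<open>\<phi> \<iota> = \<kappa> \<phi>\<close>, which avoids evaluating the inverse of
      \<open>\<phi>\<close> in \<open>AutoGroup G\<close>.\<close>
    define \<kappa> where "\<kappa> = (\<lambda>x\<in>carrier G. \<phi> g \<otimes> x \<otimes> inv (\<phi> g))"
    have \<kappa>: "\<kappa> \<in> Inn G" using auto_closed[OF \<phi> g] by (auto simp: \<kappa>_def Inn_def)
    then have "\<kappa> \<in> auto G" "\<iota> \<in> auto G" using Inn_subset_auto \<open>\<iota> \<in> Inn G\<close> by auto
    moreover have "\<phi> \<otimes>\<^bsub>AutoGroup G\<^esub> \<iota> = \<kappa> \<otimes>\<^bsub>AutoGroup G\<^esub> \<phi>"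
      using \<phi> g calculation
      by (auto simp: mult_AutoGroup compose_def restrict_def fun_eq_iff \<iota> \<kappa>_def auto_closed
          auto_mult auto_inv)
    ultimately show ?thesis
      using \<kappa> \<phi> by (metis A.inv_closed A.m_assoc A.r_inv A.r_one carrier_AutoGroup)
  qed
  moreover have "subgroup (Inn G) (AutoGroup G)"
    using h.img_is_subgroup by (simp add: Inn_def)
  ultimately show ?thesis by (simp add: A.normal_inv_iff)
qed

lemma group_Out: "group (Out G)"
  by (simp add: Out_def normal.factorgroup_is_group[OF normal_Inn])

lemma carrier_Out: "carrier (Out G) = outer_class G ` auto G"
  by (auto simp: Out_def carrier_FactGroup outer_class_def)

text \<open>The universal property of the quotient, in the form used for both vertices and arcs. The
  unit law is an instance of the assumption on \<open>Inn G\<close>, which contains the identity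
  automorphism.\<close>

lemma Out_action_if_Inn_trivial:
  assumes closed: "\<And>\<phi> x. \<phi> \<in> auto G \<Longrightarrow> x \<in> E \<Longrightarrow> f \<phi> x \<in> E"
    and mult: "\<And>\<phi> \<psi> x. \<phi> \<in> auto G \<Longrightarrow> \<psi> \<in> auto G \<Longrightarrow> x \<in> E \<Longrightarrow>
                 f (compose (carrier G) \<phi> \<psi>) x = f \<phi> (f \<psi> x)"
    and Inn: "\<And>\<iota> x. \<iota> \<in> Inn G \<Longrightarrow> x \<in> E \<Longrightarrow> f \<iota> x = x"
  obtains \<rho> where "group_action (Out G) E \<rho>"
    and "\<And>\<phi> x. \<phi> \<in> auto G \<Longrightarrow> x \<in> E \<Longrightarrow> \<rho> (outer_class G \<phi>) x = f \<phi> x"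
proof -
  interpret A: group "AutoGroup G" by (rule AutoGroup)
  interpret N: normal "Inn G" "AutoGroup G" by (rule normal_Inn)
  have "group_action (AutoGroup G) E (\<lambda>\<phi>. restrict (f \<phi>) E)"
    using closed mult Inn[OF N.one_closed]
    by (intro group_actionI A.is_group) (simp_all add: mult_AutoGroup)
  then have "(\<lambda>\<phi>. restrict (f \<phi>) E) \<in> hom (AutoGroup G) (BijGroup E)"
    by (simp add: group_action_def group_hom_def group_hom_axioms_def)
  \<comment> \<open>Independence of the representative: automorphisms in one coset differ by an
    inner factor on the left, which acts trivially on \<open>E\<close>.\<close>
  moreover have "restrict (f \<phi>) E = restrict (f \<psi>) E"
    if "\<phi> \<in> carrier (AutoGroup G)" "\<psi> \<in> carrier (AutoGroup G)"
      and eq: "Inn G #>\<^bsub>AutoGroup G\<^esub> \<phi> = Inn G #>\<^bsub>AutoGroup G\<^esub> \<psi>" for \<phi> \<psi>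
  proof -
    have "\<phi> \<in> Inn G #>\<^bsub>AutoGroup G\<^esub> \<psi>"
      using A.rcos_self[OF that(1) N.subgroup_axioms] eq by simp
    then obtain \<iota> where \<iota>: "\<iota> \<in> Inn G" "\<phi> = \<iota> \<otimes>\<^bsub>AutoGroup G\<^esub> \<psi>"
      by (auto simp: r_coset_def)
    then have "\<iota> \<in> auto G" using Inn_subset_auto by auto
    then show ?thesis
      using \<iota> that by (auto simp: mult_AutoGroup mult Inn closed)
  qed
  ultimately obtain \<rho> where \<rho>: "\<rho> \<in> hom (Out G) (BijGroup E)"
    "\<And>\<phi>. \<phi> \<in> auto G \<Longrightarrow> \<rho> (outer_class G \<phi>) = restrict (f \<phi>) E"
    using FactGroup_universal[OF _ normal_Inn, of "\<lambda>\<phi>. restrict (f \<phi>) E"]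
    by (metis Out_def outer_class_def carrier_AutoGroup)
  have "group_action (Out G) E \<rho>"
    unfolding group_action_def using \<rho>(1)
    by (intro group_hom.intro group_hom_axioms.intro group_Out group_BijGroup)
  with \<rho>(2) show thesis using that by simp
qed

section \<open>Automorphisms and conjugacy classes\<close>

lemma conj_class_subset: "v \<in> carrier G \<Longrightarrow> conj_class G v \<subseteq> carrier G"
  by (auto simp: conj_class_def)

lemma conj_class_self: "v \<in> carrier G \<Longrightarrow> v \<in> conj_class G v"
  by (auto simp: conj_class_def intro!: exI[of _ \<one>])

text \<open>Since \<open>\<phi>\<close> is onto, \<open>\<phi> g\<close> runs through all
  conjugators. Thus the map from the class of \<open>v\<close> to the class of
  \<open>\<phi> v\<close> is simply the set image, and no representative has to be chosen.\<close>

lemma auto_image_conj_class: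
  assumes \<phi>: "\<phi> \<in> auto G" and v: "v \<in> carrier G"
  shows "\<phi> ` conj_class G v = conj_class G (\<phi> v)"
proof -
  have conj_class: "conj_class G u = (\<lambda>g. g \<otimes> u \<otimes> inv g) ` carrier G" for u
    by (auto simp: conj_class_def)
  have "\<phi> ` conj_class G v = (\<lambda>g. \<phi> g \<otimes> \<phi> v \<otimes> inv (\<phi> g)) ` carrier G"
    unfolding conj_class image_image
    by (rule image_cong) (use \<phi> v in \<open>simp_all add: auto_mult auto_inv\<close>)
  also have "\<dots> = (\<lambda>g. g \<otimes> \<phi> v \<otimes> inv g) ` \<phi> ` carrier G"
    by (simp add: image_image)
  also have "\<phi> ` carrier G = carrier G"
    using auto_bij[OF \<phi>] by (simp add: bij_betw_def)
  finally show ?thesis by (simp add: conj_class)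
qed

lemma conj_class_conj:
  assumes g: "g \<in> carrier G" and v: "v \<in> carrier G"
  shows "conj_class G (g \<otimes> v \<otimes> inv g) = conj_class G v"
proof (intro equalityI subsetI)
  fix x assume "x \<in> conj_class G (g \<otimes> v \<otimes> inv g)"
  then obtain k where "k \<in> carrier G" "x = k \<otimes> (g \<otimes> v \<otimes> inv g) \<otimes> inv k"
    by (auto simp: conj_class_def)
  then have "x = (k \<otimes> g) \<otimes> v \<otimes> inv (k \<otimes> g)" "k \<otimes> g \<in> carrier G"
    using g v by (simp_all add: m_assoc inv_mult_group)
  then show "x \<in> conj_class G v" by (auto simp: conj_class_def)
next
  fix x assume "x \<in> conj_class G v"
  then obtain k where "k \<in> carrier G" "x = k \<otimes> v \<otimes> inv k"
    by (auto simp: conj_class_def)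
  then have "x = (k \<otimes> inv g) \<otimes> (g \<otimes> v \<otimes> inv g) \<otimes> inv (k \<otimes> inv g)" "k \<otimes> inv g \<in> carrier G"
    using g v by (simp_all add: m_assoc inv_mult_group inv_mult_cancel_left)
  then show "x \<in> conj_class G (g \<otimes> v \<otimes> inv g)" unfolding conj_class_def by blast
qed

lemma Inn_image_conj_class:
  assumes "\<iota> \<in> Inn G" and v: "v \<in> carrier G"
  shows "\<iota> ` conj_class G v = conj_class G v"
proof -
  obtain g where g: "g \<in> carrier G" and \<iota>: "\<iota> = (\<lambda>x\<in>carrier G. g \<otimes> x \<otimes> inv g)"
    using assms(1) by (auto simp: Inn_def)
  have "\<iota> ` conj_class G v = conj_class G (\<iota> v)"
    using assms Inn_subset_auto by (intro auto_image_conj_class) auto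
  then show ?thesis using g v by (simp add: \<iota> conj_class_conj)
qed

section \<open>Automorphisms, free factors and separable elements\<close>

lemma auto_image_subgroup:
  assumes "\<phi> \<in> auto G" "subgroup A G"
  shows "subgroup (\<phi> ` A) G"
  using group_hom.subgroup_img_is_subgroup[OF auto_group_hom] assms by blast

lemma auto_image_eq_one_iff:
  assumes \<phi>: "\<phi> \<in> auto G" and x: "x \<in> carrier G"
  shows "\<phi> x = \<one> \<longleftrightarrow> x = \<one>"
  using auto_bij[OF \<phi>] x auto_one[OF \<phi>] by (metis bij_betw_def inj_onD one_closed)

lemma auto_image_proper:
  assumes \<phi>: "\<phi> \<in> auto G" and A: "A \<subseteq> carrier G"
  shows "\<phi> ` A = {\<one>} \<longleftrightarrow> A = {\<one>}" "\<phi> ` A = carrier G \<longleftrightarrow> A = carrier G"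
proof -
  have inj: "inj_on \<phi> (carrier G)" and img: "\<phi> ` carrier G = carrier G"
    using auto_bij[OF \<phi>] by (auto simp: bij_betw_def)
  have "\<phi> ` {\<one>} = {\<one>}" using auto_one[OF \<phi>] by simp
  then show "\<phi> ` A = {\<one>} \<longleftrightarrow> A = {\<one>}"
    using inj_on_image_eq_iff[OF inj A, of "{\<one>}"] by simp
  show "\<phi> ` A = carrier G \<longleftrightarrow> A = carrier G"
    using inj_on_image_eq_iff[OF inj A, of "carrier G"] img by simp
qed

text \<open>The tags, and with them the alternation, are untouched, and injectivity of
  \<open>\<phi>\<close> keeps letters nontrivial. For the converse, preimages are chosen letter by
  letter; they are nontrivial because \<open>\<phi>\<close> fixes the unit.\<close>

lemma alternating_words_image:
  assumes \<phi>: "\<phi> \<in> auto G" and A: "A \<subseteq> carrier G" and B: "B \<subseteq> carrier G"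
  shows "map (apsnd \<phi>) ` alternating_words G A B = alternating_words G (\<phi> ` A) (\<phi> ` B)"
proof (intro equalityI subsetI)
  fix ws assume "ws \<in> map (apsnd \<phi>) ` alternating_words G A B"
  then obtain us where us: "us \<in> alternating_words G A B" and ws: "ws = map (apsnd \<phi>) us"
    by blast
  have "\<phi> x \<in> (if b then \<phi> ` A else \<phi> ` B) - {\<one>}" if "(b, x) \<in> set us" for b x
  proof -
    have "x \<in> (if b then A else B) - {\<one>}" using us that by (auto simp: alternating_words_def)
    moreover have "x \<in> carrier G" using calculation A B by (auto split: if_splits)
    ultimately show ?thesis using auto_image_eq_one_iff[OF \<phi>, of x] by auto
  qed
  then show "ws \<in> alternating_words G (\<phi> ` A) (\<phi> ` B)"
    using us by (auto simp: ws alternating_words_def successively_map)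
next
  fix ws assume "ws \<in> alternating_words G (\<phi> ` A) (\<phi> ` B)"
  then have succ: "successively (\<lambda>s t. fst s \<noteq> fst t) ws"
    and letters: "\<And>b y. (b, y) \<in> set ws \<Longrightarrow> y \<in> (if b then \<phi> ` A else \<phi> ` B) - {\<one>}"
    by (auto simp: alternating_words_def)
  have "\<exists>x. snd s = \<phi> x \<and> x \<in> (if fst s then A else B) - {\<one>}" if "s \<in> set ws" for s
    using letters[of "fst s" "snd s"] that auto_one[OF \<phi>] by (auto split: if_splits)
  then obtain h where h: "\<And>s. s \<in> set ws \<Longrightarrow> snd s = \<phi> (h s)"
    "\<And>s. s \<in> set ws \<Longrightarrow> h s \<in> (if fst s then A else B) - {\<one>}"
    by metis
  define us where "us = map (\<lambda>s. (fst s, h s)) ws"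
  have "us \<in> alternating_words G A B"
    using succ h(2) by (auto simp: us_def alternating_words_def successively_map)
  moreover have "map (apsnd \<phi>) us = ws"
    using h(1) by (auto simp: us_def intro!: map_idI prod_eqI)
  ultimately show "ws \<in> map (apsnd \<phi>) ` alternating_words G A B" by blast
qed

text \<open>Membership in the carrier is carried through the induction because \<open>\<phi>\<close>
  is multiplicative only there.\<close>

lemma auto_word_value:
  assumes \<phi>: "\<phi> \<in> auto G" and "snd ` set ws \<subseteq> carrier G"
  shows "word_value G ws \<in> carrier G \<and>
         word_value G (map (apsnd \<phi>) ws) = \<phi> (word_value G ws)"
  using assms(2) by (induction ws) (auto simp: word_value_def auto_one[OF \<phi>] auto_mult[OF \<phi>])

text \<open>A commuting square: evaluating and then applying \<open>\<phi>\<close> equals applying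
  \<open>\<phi>\<close> to each letter and then evaluating. Three of its sides are bijections, hence
  so is the evaluation of words in the image factors.\<close>

lemma is_free_product_auto_image:
  assumes \<phi>: "\<phi> \<in> auto G" and AB: "is_free_product G A B"
  shows "is_free_product G (\<phi> ` A) (\<phi> ` B)"
proof -
  have sub: "subgroup A G" "subgroup B G" using AB by (auto simp: is_free_product_def)
  then have A: "A \<subseteq> carrier G" and B: "B \<subseteq> carrier G" by (simp_all add: subgroup.subset)
  let ?W = "alternating_words G A B"
  have W: "snd ` set ws \<subseteq> carrier G" if "ws \<in> ?W" for ws
    using that A B by (fastforce simp: alternating_words_def split: if_splits)
  have inj: "inj_on \<phi> (carrier G)" using auto_bij[OF \<phi>] by (simp add: bij_betw_def)
  have "inj_on (map (apsnd \<phi>)) ?W"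
  proof (rule inj_onI)
    fix us ws assume "us \<in> ?W" "ws \<in> ?W" and eq: "map (apsnd \<phi>) us = map (apsnd \<phi>) ws"
    then have "set us \<union> set ws \<subseteq> UNIV \<times> carrier G" using W by fastforce
    moreover have "inj_on (apsnd \<phi>) (UNIV \<times> carrier G)"
      using inj by (auto simp: inj_on_def)
    ultimately show "us = ws" using eq by (metis map_inj_on inj_on_subset)
  qed
  then have bij: "bij_betw (map (apsnd \<phi>)) ?W (alternating_words G (\<phi> ` A) (\<phi> ` B))"
    using alternating_words_image[OF \<phi> A B] by (simp add: bij_betw_def)
  have "bij_betw (\<phi> \<circ> word_value G) ?W (carrier G)"
    using AB auto_bij[OF \<phi>] unfolding is_free_product_def by (blast intro: bij_betw_trans)
  then have "bij_betw (word_value G \<circ> map (apsnd \<phi>)) ?W (carrier G)"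
    using auto_word_value[OF \<phi>] W by (subst bij_betw_cong[where g = "\<phi> \<circ> word_value G"]) auto
  then have "bij_betw (word_value G) (alternating_words G (\<phi> ` A) (\<phi> ` B)) (carrier G)"
    using bij_betw_comp_iff[OF bij] by blast
  then show ?thesis
    using sub auto_image_subgroup[OF \<phi>] by (simp add: is_free_product_def)
qed

text \<open>The image of a complementary factor of \<open>A\<close> serves as a complementary factor
  of the image of \<open>A\<close>.\<close>

lemma proper_free_factor_auto_image:
  assumes \<phi>: "\<phi> \<in> auto G" and "proper_free_factor G A"
  shows "proper_free_factor G (\<phi> ` A)"
  using assms is_free_product_auto_image[OF \<phi>] auto_image_proper[OF \<phi>] auto_image_subgroup[OF \<phi>]
  unfolding proper_free_factor_def by (metis subgroup.subset)

lemma auto_separable: "\<phi> \<in> auto G \<Longrightarrow> x \<in> separable G \<Longrightarrow> \<phi> x \<in> separable G"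
  using proper_free_factor_auto_image by (auto simp: separable_def)

text \<open>A free factor is a subgroup. This handles inverses of generators in the subgroup
  generated by separable elements.\<close>

lemma inv_separable: "x \<in> separable G \<Longrightarrow> inv x \<in> separable G"
  by (auto simp: separable_def proper_free_factor_def subgroup.m_inv_closed)

end


section \<open>Group actions on digraphs\<close>

text \<open>Gives the component of \<open>v\<close> explicitly, as the subgraph induced on the
  vertices joined to \<open>v\<close> by walks that ignore the direction of arcs.\<close>

lemma (in wf_digraph) connected_component_reachable:
  assumes v: "v \<in> verts G"
  shows "connected_component G (G \<restriction> {u. v \<rightarrow>\<^sup>*\<^bsub>mk_symmetric G\<^esub> u})"
proof -
  let ?S = "{u. v \<rightarrow>\<^sup>*\<^bsub>mk_symmetric G\<^esub> u}"
  let ?C = "G \<restriction> ?S"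
  interpret M: pair_wf_digraph "mk_symmetric G" ..
  interpret C: wf_digraph ?C ..
  interpret MC: pair_wf_digraph "mk_symmetric ?C" ..
  have S: "?S \<subseteq> verts G" using M.reachable_in_verts by auto
  have sub: "subgraph ?C G"
    using S by (simp add: induced_imp_subgraph induced_induce)
  \<comment> \<open>Every vertex on a walk from \<open>v\<close> is itself reachable from
    \<open>v\<close>, so such a walk survives in the induced subgraph.\<close>
  have from_v: "v \<rightarrow>\<^sup>*\<^bsub>mk_symmetric ?C\<^esub> u" if "v \<rightarrow>\<^sup>*\<^bsub>mk_symmetric G\<^esub> u" for u
    using that
  proof (induction rule: M.reachable_induct)
    case base
    then show ?case by simp
  next
    case (step x y)
    then have "v \<rightarrow>\<^sup>*\<^bsub>mk_symmetric G\<^esub> y" by (auto intro: M.reachable_adj_trans)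
    with step have "x \<rightarrow>\<^bsub>mk_symmetric ?C\<^esub> y" by (auto simp: parcs_mk_symmetric)
    with step show ?case by (auto intro: MC.reachable_adj_trans)
  qed
  have "Digraph_Component.connected ?C"
    unfolding connected_def
  proof (rule strongly_connectedI)
    fix x y
    assume "x \<in> verts (with_proj (mk_symmetric ?C))" "y \<in> verts (with_proj (mk_symmetric ?C))"
    then have "v \<rightarrow>\<^sup>*\<^bsub>mk_symmetric G\<^esub> x" "v \<rightarrow>\<^sup>*\<^bsub>mk_symmetric G\<^esub> y"
      by simp_all
    \<comment> \<open>Any two vertices are joined through \<open>v\<close>, by reversing the walk
      from \<open>v\<close> to \<open>x\<close>.\<close>
    then have "x \<rightarrow>\<^sup>*\<^bsub>mk_symmetric ?C\<^esub> v" "v \<rightarrow>\<^sup>*\<^bsub>mk_symmetric ?C\<^esub> y"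
      by (auto intro: symmetric_reachable[OF symmetric_mk_symmetric] from_v)
    then show "x \<rightarrow>\<^sup>*\<^bsub>mk_symmetric ?C\<^esub> y"
      by (rule MC.reachable_trans)
  qed (use v in \<open>auto intro!: exI[of _ v]\<close>)
  \<comment> \<open>Maximality: a connected \<open>D\<close> above \<open>?C\<close> contains
    \<open>v\<close>, so all its vertices are reachable from \<open>v\<close>; its arcs have both
    ends among them and therefore already belong to the induced subgraph.\<close>
  moreover have "D = ?C"
    if CD: "subgraph ?C D" and DG: "subgraph D G" and conn: "Digraph_Component.connected D" for D
  proof -
    have "v \<in> verts D" using CD v by (auto simp: subgraph_def)
    then have "verts D \<subseteq> ?S"
      using conn M.reachable_mono[OF _ subgraph_mk_symmetric[OF DG]]
      by (auto simp: connected_def strongly_connected_def)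
    moreover interpret D: wf_digraph D using DG by (simp add: subgraph_def)
    have "tail D = tail G" "head D = head G" using DG by (auto simp: subgraph_def compatible_def)
    ultimately have "verts D = verts ?C" "arcs D = arcs ?C"
      using CD DG D.wellformed by (auto simp: subgraph_def)
    then show ?thesis
      using \<open>tail D = tail G\<close> \<open>head D = head G\<close> by (intro pre_digraph.equality) auto
  qed
  ultimately show ?thesis
    using sub unfolding connected_component_def max_subgraph_def by blast
qed

text \<open>The purely graph-theoretic part: isometry and invariance of a component follow from
  compatible actions on vertices and arcs alone.\<close>

locale digraph_action =
  wf_digraph D + V: group_action K "verts D" a + A: group_action K "arcs D" b
  for D :: "('v, 'e) pre_digraph" and K (structure) and a b +
  assumes tail_action: "k \<in> carrier K \<Longrightarrow> e \<in> arcs D \<Longrightarrow> tail D (b k e) = a k (tail D e)"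
    and head_action: "k \<in> carrier K \<Longrightarrow> e \<in> arcs D \<Longrightarrow> head D (b k e) = a k (head D e)"
begin

sublocale K: group K
  using V.group_hom by (simp add: group_hom_def)

interpretation M: pair_wf_digraph "mk_symmetric D" ..

lemma parcs_action:
  assumes "k \<in> carrier K" "(x, y) \<in> parcs (mk_symmetric D)"
  shows "(a k x, a k y) \<in> parcs (mk_symmetric D)"
  using assms tail_action[OF assms(1)] head_action[OF assms(1)] A.element_image[OF assms(1)]
  unfolding parcs_mk_symmetric by fastforce

text \<open>The arcs of \<open>mk_symmetric D\<close> are pairs of vertices, so the vertex action
  alone determines the image of a walk.\<close>

lemma awalk_action:
  assumes k: "k \<in> carrier K" and "M.awalk x p y"
  shows "M.awalk (a k x) (map (map_prod (a k) (a k)) p) (a k y)"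
  using assms(2)
proof (induction p arbitrary: x)
  case Nil
  then show ?case using V.element_image[OF k] by (auto simp: M.awalk_Nil_iff)
next
  case (Cons e p)
  then show ?case using parcs_action[OF k] by (cases e) (auto simp: M.awalk_Cons_iff)
qed

text \<open>The distance is an infimum over walks, and each walk from \<open>x\<close> to
  \<open>y\<close> has an image of the same length. If there is no such walk, the right-hand side is
  infinite.\<close>

lemma path_dist_action_le:
  assumes k: "k \<in> carrier K"
  shows "path_dist D (a k x) (a k y) \<le> path_dist D x y"
  unfolding path_dist_def M.\<mu>_def
proof (rule INF_mono)
  fix p assume "p \<in> {p. M.awalk x p y}"
  then show "\<exists>q\<in>{q. M.awalk (a k x) q (a k y)}.
      ereal (M.awalk_cost (\<lambda>_. 1) q) \<le> ereal (M.awalk_cost (\<lambda>_. 1) p)"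
    using awalk_action[OF k]
    by (intro bexI[where x = "map (map_prod (a k) (a k)) p"])
      (auto simp: M.awalk_cost_def o_def)
qed

text \<open>The reverse inequality is the previous one for \<open>inv k\<close>, applied to the
  image points.\<close>

lemma path_dist_action:
  assumes k: "k \<in> carrier K" and "x \<in> verts D" "y \<in> verts D"
  shows "path_dist D (a k x) (a k y) = path_dist D x y"
proof (rule antisym)
  show "path_dist D x y \<le> path_dist D (a k x) (a k y)"
    using path_dist_action_le[of "inv k" "a k x" "a k y"] assms
    by (simp add: V.orbit_sym_aux)
qed (rule path_dist_action_le[OF k])

lemma reachable_action:
  assumes "k \<in> carrier K" "x \<rightarrow>\<^sup>*\<^bsub>mk_symmetric D\<^esub> y"
  shows "a k x \<rightarrow>\<^sup>*\<^bsub>mk_symmetric D\<^esub> a k y"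
  using assms awalk_action by (metis M.reachable_awalk)

lemma fixed_component_action:
  assumes fixed: "\<And>k. k \<in> carrier K \<Longrightarrow> a k v = v" and k: "k \<in> carrier K"
  defines "C \<equiv> D \<restriction> {u. v \<rightarrow>\<^sup>*\<^bsub>mk_symmetric D\<^esub> u}"
  shows "a k ` verts C = verts C" "b k ` arcs C = arcs C"
proof -
  have C: "verts C \<subseteq> verts D" "arcs C \<subseteq> arcs D"
    using M.reachable_in_verts by (auto simp: C_def)
  have verts: "a k ` verts C \<subseteq> verts C" if "k \<in> carrier K" for k
    using reachable_action[OF that, of v] fixed[OF that] by (auto simp: C_def)
  \<comment> \<open>An arc of \<open>D\<close> belongs to \<open>C\<close> exactly when both its
    ends do, so invariance of the arcs reduces to that of the vertices.\<close>
  have arcs: "b k ` arcs C \<subseteq> arcs C" if k: "k \<in> carrier K" for k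
  proof
    fix e' assume "e' \<in> b k ` arcs C"
    then obtain e where e: "e \<in> arcs C" and e': "e' = b k e" by blast
    then have "e \<in> arcs D" "tail D e \<in> verts C" "head D e \<in> verts C" by (auto simp: C_def)
    then have "b k e \<in> arcs D" "tail D (b k e) \<in> verts C" "head D (b k e) \<in> verts C"
      using verts[OF k] A.element_image[OF k] by (auto simp: tail_action[OF k] head_action[OF k])
    then show "e' \<in> arcs C" by (simp add: C_def e')
  qed
  have inv: "inv k \<in> carrier K" using k by simp
  \<comment> \<open>Inclusion for \<open>inv k\<close> turns inclusion for \<open>k\<close> into
    equality.\<close>
  have "x \<in> a k ` verts C" if "x \<in> verts C" for x
  proof (rule image_eqI)
    show "x = a k (a (inv k) x)" using V.orbit_sym_aux[OF inv, of x] k C(1) that by auto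
    show "a (inv k) x \<in> verts C" using verts[OF inv] that by blast
  qed
  with verts[OF k] show "a k ` verts C = verts C" by blast
  have "e \<in> b k ` arcs C" if "e \<in> arcs C" for e
  proof (rule image_eqI)
    show "e = b k (b (inv k) e)" using A.orbit_sym_aux[OF inv, of e] k C(2) that by auto
    show "b (inv k) e \<in> arcs C" using arcs[OF inv] that by blast
  qed
  with arcs[OF k] show "b k ` arcs C = arcs C" by blast
qed

end


section \<open>The separability complex\<close>

lemma verts_separability_complex [simp]: "verts (separability_complex G H) = conj_class G ` H"
  by (simp add: separability_complex_def)

lemma wf_separability_complex: "wf_digraph (separability_complex G H)"
  by unfold_locales (auto simp: separability_complex_def)

context group
begin

section \<open>Paths from the trivial class, and the induced actions\<close>

lemma characteristic_auto_closed:
  "characteristic_subgroup H G \<Longrightarrow> \<phi> \<in> auto G \<Longrightarrow> v \<in> H \<Longrightarrow> \<phi> v \<in> H"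
  by (auto simp: characteristic_subgroup_def)

lemma pi1_sep_reachable:
  assumes H: "subgroup H G" and h: "h \<in> pi1_sep G H"
  shows "conj_class G \<one> \<rightarrow>\<^sup>*\<^bsub>mk_symmetric (separability_complex G H)\<^esub> conj_class G h"
proof -
  let ?M = "mk_symmetric (separability_complex G H)"
  interpret wf_digraph "separability_complex G H" by (rule wf_separability_complex)
  interpret M: pair_wf_digraph ?M ..
  interpret H: subgroup H G by fact
  \<comment> \<open>A trivial \<open>a\<close> labels no edge, but then the two classes coincide.
    Otherwise \<open>v\<close>, \<open>a\<close> and \<open>v \<otimes> a\<close> themselves witness
    the edge.\<close>
  have sep_step: "conj_class G v \<rightarrow>\<^sup>*\<^bsub>?M\<^esub> conj_class G (v \<otimes> a)"
    if "v \<in> H" "a \<in> separable G \<inter> H" for v a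
  proof (cases "a = \<one>")
    case True
    then show ?thesis using that by (auto intro!: M.reachable_refl)
  next
    case False
    let ?e = "(conj_class G v, conj_class G a, conj_class G (v \<otimes> a))"
    have "v \<in> conj_class G v" "a \<in> conj_class G a" "v \<otimes> a \<in> conj_class G (v \<otimes> a)"
      using that conj_class_self by auto
    then have "?e \<in> arcs (separability_complex G H)"
      using that False by (auto simp: separability_complex_def)
    then have "(conj_class G v, conj_class G (v \<otimes> a)) \<in> parcs ?M"
      by (force simp: parcs_mk_symmetric separability_complex_def)
    then show ?thesis by (auto intro: M.reachable_adjI)
  qed
  \<comment> \<open>The start \<open>v\<close> is arbitrary, so that for a product the path for
    \<open>h2\<close> can begin where the path for \<open>h1\<close> ends; \<open>h \<in> H\<close>
    is kept so that this point is again in \<open>H\<close>.\<close>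
  have "h \<in> H \<and> (\<forall>v\<in>H. conj_class G v \<rightarrow>\<^sup>*\<^bsub>?M\<^esub> conj_class G (v \<otimes> h))"
    using h unfolding pi1_sep_def
  proof (induction h rule: generate.induct)
    case one
    then show ?case by (auto intro!: M.reachable_refl)
  next
    case (incl a)
    then show ?case using sep_step by auto
  next
    case (inv a)
    then show ?case using sep_step[of _ "inv a"] inv_separable by auto
  next
    case (eng h1 h2)
    then show ?case by (auto simp: m_assoc[symmetric] intro: M.reachable_trans)
  qed
  then have "conj_class G \<one> \<rightarrow>\<^sup>*\<^bsub>?M\<^esub> conj_class G (\<one> \<otimes> h)" "h \<in> carrier G"
    using H.one_closed H.mem_carrier by blast+
  then show ?thesis by simp
qed

lemma Out_action_separability_complex_verts:
  assumes char: "characteristic_subgroup H G"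
  obtains \<rho> where "group_action (Out G) (verts (separability_complex G H)) \<rho>"
    and "\<And>\<phi> X. \<phi> \<in> auto G \<Longrightarrow> X \<in> verts (separability_complex G H) \<Longrightarrow>
           \<rho> (outer_class G \<phi>) X = \<phi> ` X"
proof -
  have H: "H \<subseteq> carrier G"
    using char by (auto simp: characteristic_subgroup_def dest: subgroup.subset)
  show thesis
  proof (rule Out_action_if_Inn_trivial[where E = "verts (separability_complex G H)" and f = image])
    fix \<phi> X assume "\<phi> \<in> auto G" "X \<in> verts (separability_complex G H)"
    then obtain v where "v \<in> H" "X = conj_class G v" by auto
    then show "\<phi> ` X \<in> verts (separability_complex G H)"
      using \<open>\<phi> \<in> auto G\<close> H characteristic_auto_closed[OF char] auto_image_conj_class by auto
  next
    fix \<phi> \<psi> X assume "\<phi> \<in> auto G" "\<psi> \<in> auto G" "X \<in> verts (separability_complex G H)"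
    \<comment> \<open>\<open>compose (carrier G)\<close> is the genuine composite only on the
      carrier.\<close>
    then have "X \<subseteq> carrier G"
      using H conj_class_subset by auto
    then show "compose (carrier G) \<phi> \<psi> ` X = \<phi> ` \<psi> ` X"
      by (force simp: compose_def)
  next
    fix \<iota> X assume \<iota>: "\<iota> \<in> Inn G" and "X \<in> verts (separability_complex G H)"
    then obtain v where "v \<in> H" "X = conj_class G v" by auto
    then show "\<iota> ` X = X"
      using H Inn_image_conj_class[OF \<iota>] by blast
  qed (rule that)
qed

lemma auto_separability_complex_arc:
  assumes char: "characteristic_subgroup H G" and \<phi>: "\<phi> \<in> auto G"
    and e: "(V, A, W) \<in> arcs (separability_complex G H)"
  shows "(\<phi> ` V, \<phi> ` A, \<phi> ` W) \<in> arcs (separability_complex G H)"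
proof -
  have H: "H \<subseteq> carrier G"
    using char by (auto simp: characteristic_subgroup_def dest: subgroup.subset)
  obtain v a w where cls: "v \<in> H" "V = conj_class G v" "a \<in> separable G \<inter> H - {\<one>}"
      "A = conj_class G a" "w \<in> H" "W = conj_class G w"
    using e by (auto simp: separability_complex_def)
  \<comment> \<open>The representatives realizing the edge are separate from \<open>v\<close>,
    \<open>a\<close>, \<open>w\<close>, which only record what kind of classes these are.\<close>
  obtain v' a' where rep: "v' \<in> V" "a' \<in> A" "v' \<otimes> a' \<in> W"
    using e by (auto simp: separability_complex_def)
  have carrier: "v' \<in> carrier G" "a' \<in> carrier G" using rep cls H conj_class_subset by auto
  have "\<phi> v' \<in> \<phi> ` V" "\<phi> a' \<in> \<phi> ` A" "\<phi> v' \<otimes> \<phi> a' \<in> \<phi> ` W"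
    using rep by (auto simp flip: auto_mult[OF \<phi> carrier])
  moreover have "\<phi> a \<in> separable G \<inter> H - {\<one>}"
    using cls(3) H auto_separable[OF \<phi>] characteristic_auto_closed[OF char \<phi>]
      auto_image_eq_one_iff[OF \<phi>] by auto
  moreover have "\<phi> v \<in> H" "\<phi> w \<in> H" using cls characteristic_auto_closed[OF char \<phi>] by auto
  moreover have "\<phi> ` V = conj_class G (\<phi> v)" "\<phi> ` A = conj_class G (\<phi> a)"
      "\<phi> ` W = conj_class G (\<phi> w)"
    using cls H auto_image_conj_class[OF \<phi>] by auto
  ultimately show ?thesis by (auto simp: separability_complex_def)
qed

lemma Out_action_separability_complex_arcs:
  assumes char: "characteristic_subgroup H G"
  obtains \<rho> where "group_action (Out G) (arcs (separability_complex G H)) \<rho>"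
    and "\<And>\<phi> V A W. \<phi> \<in> auto G \<Longrightarrow> (V, A, W) \<in> arcs (separability_complex G H) \<Longrightarrow>
           \<rho> (outer_class G \<phi>) (V, A, W) = (\<phi> ` V, \<phi> ` A, \<phi> ` W)"
proof -
  have H: "H \<subseteq> carrier G"
    using char by (auto simp: characteristic_subgroup_def dest: subgroup.subset)
  \<comment> \<open>All three coordinates of an edge are conjugacy classes, so taking images in each
    coordinate is trivial for inner automorphisms.\<close>
  let ?f = "\<lambda>\<phi>. map_prod (image \<phi>) (map_prod (image \<phi>) (image \<phi>))"
  let ?E = "arcs (separability_complex G H)"
  obtain \<rho> where "group_action (Out G) ?E \<rho>"
    "\<And>\<phi> x. \<phi> \<in> auto G \<Longrightarrow> x \<in> ?E \<Longrightarrow> \<rho> (outer_class G \<phi>) x = ?f \<phi> x"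
  proof (rule Out_action_if_Inn_trivial[where E = ?E and f = ?f])
    fix \<phi> x assume "\<phi> \<in> auto G" "x \<in> ?E"
    then show "?f \<phi> x \<in> ?E"
      using auto_separability_complex_arc[OF char] by (cases x) auto
  next
    fix \<phi> \<psi> x assume "\<phi> \<in> auto G" "\<psi> \<in> auto G" "x \<in> ?E"
    moreover obtain V A W where x: "x = (V, A, W)" by (cases x)
    ultimately have "V \<subseteq> carrier G" "A \<subseteq> carrier G" "W \<subseteq> carrier G"
      using H conj_class_subset by (auto simp: separability_complex_def)
    then show "?f (compose (carrier G) \<phi> \<psi>) x = ?f \<phi> (?f \<psi> x)"
      by (force simp: compose_def x)
  next
    fix \<iota> x assume "\<iota> \<in> Inn G" "x \<in> ?E"
    moreover obtain V A W where x: "x = (V, A, W)" by (cases x)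
    ultimately have "\<iota> ` V = V" "\<iota> ` A = A" "\<iota> ` W = W"
      using H Inn_image_conj_class[of \<iota>] by (auto simp: separability_complex_def subset_iff)
    then show "?f \<iota> x = x" by (simp add: x)
  qed auto
  then show thesis using that by fastforce
qed

end

theorem proposition3p9:
  fixes n :: nat
    and \<Gamma> :: "('v, 'e) pre_digraph" and rev\<Gamma> :: "'e \<Rightarrow> 'e"
    and pv :: "'v \<Rightarrow> unit" and pe :: "'e \<Rightarrow> nat letter" and v0 :: 'v
    and F :: "nat letter list monoid" and H :: "nat letter list set"
    and SC :: "(nat letter list set,
                nat letter list set \<times> nat letter list set \<times> nat letter list set) pre_digraph"
  assumes "n \<ge> 2"
    and F: "F = free_group {1..n}"
    and cover: "finite_regular_covering \<Gamma> rev\<Gamma> (rose n) (rose_rev n) pv pe"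
    and v0: "v0 \<in> verts \<Gamma>"
    and H: "H = pi1 \<Gamma> pe v0"
    and char: "characteristic_subgroup H F"
    and SC: "SC = separability_complex F H"
  shows "\<exists>\<rho>V \<rho>E.
    group_action (Out F) (verts SC) \<rho>V \<and>
    group_action (Out F) (arcs SC) \<rho>E \<and>
    (\<forall>\<phi>\<in>carrier (AutoGroup F).
       (\<forall>v\<in>H. \<rho>V (outer_class F \<phi>) (conj_class F v) = conj_class F (\<phi> v)) \<and>
       (\<forall>v\<in>H. \<forall>a\<in>separable F \<inter> H - {\<one>\<^bsub>F\<^esub>}. \<forall>w\<in>H.
          (conj_class F v, conj_class F a, conj_class F w) \<in> arcs SC \<longrightarrow>
          \<rho>E (outer_class F \<phi>) (conj_class F v, conj_class F a, conj_class F w) =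
            (conj_class F (\<phi> v), conj_class F (\<phi> a), conj_class F (\<phi> w)))) \<and>
    (\<forall>\<Phi>\<in>carrier (Out F).
       (\<forall>e\<in>arcs SC. tail SC (\<rho>E \<Phi> e) = \<rho>V \<Phi> (tail SC e) \<and>
                    head SC (\<rho>E \<Phi> e) = \<rho>V \<Phi> (head SC e)) \<and>
       (\<forall>x\<in>verts SC. \<forall>y\<in>verts SC. path_dist SC (\<rho>V \<Phi> x) (\<rho>V \<Phi> y) = path_dist SC x y)) \<and>
    (\<exists>C. connected_component SC C \<and> conj_class F ` pi1_sep F H \<subseteq> verts C \<and>
       (\<forall>\<Phi>\<in>carrier (Out F). \<rho>V \<Phi> ` verts C = verts C \<and> \<rho>E \<Phi> ` arcs C = arcs C))"
proof -
  interpret group F unfolding F by (rule group_free_group)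
  have H_sub: "subgroup H F" using char by (simp add: characteristic_subgroup_def)
  then have H_carrier: "H \<subseteq> carrier F" and one_H: "\<one>\<^bsub>F\<^esub> \<in> H"
    by (simp_all add: subgroup.subset subgroup.one_closed)
  obtain \<rho>V where V: "group_action (Out F) (verts SC) \<rho>V"
    and \<rho>V: "\<And>\<phi> X. \<phi> \<in> auto F \<Longrightarrow> X \<in> verts SC \<Longrightarrow> \<rho>V (outer_class F \<phi>) X = \<phi> ` X"
    unfolding SC using Out_action_separability_complex_verts[OF char] by blast
  obtain \<rho>E where E: "group_action (Out F) (arcs SC) \<rho>E"
    and \<rho>E: "\<And>\<phi> V A W. \<phi> \<in> auto F \<Longrightarrow> (V, A, W) \<in> arcs SC \<Longrightarrow>
               \<rho>E (outer_class F \<phi>) (V, A, W) = (\<phi> ` V, \<phi> ` A, \<phi> ` W)"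
    unfolding SC using Out_action_separability_complex_arcs[OF char] by blast
  have verts_SC: "verts SC = conj_class F ` H" by (simp add: SC)
  have ends: "tail SC (X, A, Y) = X" "head SC (X, A, Y) = Y" for X A Y
    by (simp_all add: SC separability_complex_def)
  have image_class: "\<phi> ` conj_class F v = conj_class F (\<phi> v)" if "\<phi> \<in> auto F" "v \<in> H" for \<phi> v
    using that H_carrier auto_image_conj_class by blast
  interpret SC: wf_digraph SC unfolding SC by (rule wf_separability_complex)
  \<comment> \<open>An edge carries its ends as outer coordinates, so compatibility with
    \<open>tail\<close> and \<open>head\<close> is read off from the coordinatewise images.\<close>
  interpret digraph_action SC "Out F" \<rho>V \<rho>E
  proof (intro digraph_action.intro digraph_action_axioms.intro V E SC.wf_digraph_axioms)
    fix \<Phi> e assume "\<Phi> \<in> carrier (Out F)" and e: "e \<in> arcs SC"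
    then obtain \<phi> where \<phi>: "\<phi> \<in> auto F" "\<Phi> = outer_class F \<phi>" by (auto simp: carrier_Out)
    obtain X A Y where XAY: "e = (X, A, Y)" by (cases e)
    then have "X \<in> verts SC" "Y \<in> verts SC" using SC.wellformed[OF e] by (auto simp: ends)
    then show "tail SC (\<rho>E \<Phi> e) = \<rho>V \<Phi> (tail SC e)" "head SC (\<rho>E \<Phi> e) = \<rho>V \<Phi> (head SC e)"
      using e \<phi> \<rho>V \<rho>E by (auto simp: XAY ends)
  qed
  let ?v = "conj_class F \<one>\<^bsub>F\<^esub>"
  define C where "C = SC \<restriction> {u. ?v \<rightarrow>\<^sup>*\<^bsub>mk_symmetric SC\<^esub> u}"
  have "connected_component SC C"
    unfolding C_def by (rule SC.connected_component_reachable) (use one_H verts_SC in auto)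
  moreover have "conj_class F ` pi1_sep F H \<subseteq> verts C"
    using pi1_sep_reachable[OF H_sub] by (auto simp: C_def SC)
  \<comment> \<open>The class of the unit is a common fixed vertex, as every automorphism fixes the
    unit; hence its component is invariant.\<close>
  moreover have "\<rho>V \<Phi> ?v = ?v" if "\<Phi> \<in> carrier (Out F)" for \<Phi>
    using that one_H by (auto simp: carrier_Out \<rho>V verts_SC image_class auto_one)
  then have "\<forall>\<Phi>\<in>carrier (Out F). \<rho>V \<Phi> ` verts C = verts C \<and> \<rho>E \<Phi> ` arcs C = arcs C"
    using fixed_component_action[of ?v] by (simp add: C_def)
  moreover have "\<forall>\<phi>\<in>carrier (AutoGroup F).
       (\<forall>v\<in>H. \<rho>V (outer_class F \<phi>) (conj_class F v) = conj_class F (\<phi> v)) \<and>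
       (\<forall>v\<in>H. \<forall>a\<in>separable F \<inter> H - {\<one>\<^bsub>F\<^esub>}. \<forall>w\<in>H.
          (conj_class F v, conj_class F a, conj_class F w) \<in> arcs SC \<longrightarrow>
          \<rho>E (outer_class F \<phi>) (conj_class F v, conj_class F a, conj_class F w) =
            (conj_class F (\<phi> v), conj_class F (\<phi> a), conj_class F (\<phi> w)))"
    by (simp add: \<rho>V \<rho>E verts_SC image_class)
  moreover have "\<forall>\<Phi>\<in>carrier (Out F).
       (\<forall>e\<in>arcs SC. tail SC (\<rho>E \<Phi> e) = \<rho>V \<Phi> (tail SC e) \<and>
                    head SC (\<rho>E \<Phi> e) = \<rho>V \<Phi> (head SC e)) \<and>
       (\<forall>x\<in>verts SC. \<forall>y\<in>verts SC. path_dist SC (\<rho>V \<Phi> x) (\<rho>V \<Phi> y) = path_dist SC x y)"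
    by (simp add: tail_action head_action path_dist_action)
  ultimately show ?thesis
    using V E by (intro exI[of _ \<rho>V] exI[of _ \<rho>E] exI[of _ C] conjI)
qed

end
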